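(* Let $Q=\begin{pmatrix}1& 0 \\ 0 & 0 \end{pmatrix}$. Then there is a constant $c>1/20$ such that every $Q$-free $n\times n$ zero-one matrix contains a homogeneous $cn\times cn$ submatrix.
   Context: A matrix is homogeneous if all its entries are equal. A $k\times \ell$ matrix $P$ is contained in $A$ if there are rows $i_1<\dots<i_k$ and columns $j_1<\dots<j_\ell$ of $A$ with $A(i_a,j_b)=P(a,b)$ for all $a,b$; $A$ is $P$-free if it does not contain $P$. An $s\times t$ submatrix of $A$ is the restriction of $A$ to some $s$ rows and $t$ columns. Floors and ceilings are omitted. *)

theory Defs
  imports Complex_Main "Jordan_Normal_Form.DL_Submatrix"
begin

definition zero_one_mat :: "int mat \<Rightarrow> bool" where
  "zero_one_mat A \<longleftrightarrow> elements_mat A \<subseteq> {0, 1}"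

definition homogeneous_mat :: "'a mat \<Rightarrow> bool" where
  "homogeneous_mat A \<longleftrightarrow> (\<forall>x \<in> elements_mat A. \<forall>y \<in> elements_mat A. x = y)"

text \<open>
  The order of rows and columns matters: the pattern \<open>P\<close> is located by strictly increasing
  choices \<open>r\<close> of rows and \<open>s\<close> of columns, not up to permutation.
\<close>
definition contains_mat :: "'a mat \<Rightarrow> 'a mat \<Rightarrow> bool" where
  "contains_mat A P \<longleftrightarrow>
    (\<exists>r s. strict_mono_on {..<dim_row P} r \<and> strict_mono_on {..<dim_col P} s \<and>
      (\<forall>a < dim_row P. r a < dim_row A) \<and> (\<forall>b < dim_col P. s b < dim_col A) \<and>
      (\<forall>a < dim_row P. \<forall>b < dim_col P. A $$ (r a, s b) = P $$ (a, b)))"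

definition free_mat :: "'a mat \<Rightarrow> 'a mat \<Rightarrow> bool" where
  "free_mat P A \<longleftrightarrow> \<not> contains_mat A P"

definition Q_mat :: "int mat" where
  "Q_mat = mat_of_rows_list 2 [[1, 0], [0, 0]]"

definition has_homogeneous_submatrix :: "'a mat \<Rightarrow> nat \<Rightarrow> nat \<Rightarrow> bool" where
  "has_homogeneous_submatrix A s t \<longleftrightarrow>
    (\<exists>I J. I \<subseteq> {..<dim_row A} \<and> J \<subseteq> {..<dim_col A} \<and> card I = s \<and> card J = t \<and>
      homogeneous_mat (submatrix A I J))"

end

theory Submission
  imports Defs
begin

text \<open>
  Write \<open>S\<^sub>i\<close> for the set of columns in which row \<open>i\<close> has a zero, and suppose that there is no
  homogeneous \<open>k \<times> k\<close> submatrix. By \<open>Q\<close>-freeness, the zeros weakly above and the zeros weakly to the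
  left of a given zero span an all-zero submatrix, so every zero is among the first \<open>k - 1\<close> zeros of
  its row or of its column; hence there are at most \<open>2 (k - 1) n\<close> zeros and few rows are heavy.
  \<open>Q\<close>-freeness also says that \<open>S\<^sub>i \<inter> S\<^sub>j\<close> is an initial segment of \<open>S\<^sub>j\<close> for \<open>i < j\<close>. So the trace
  of \<open>S\<^sub>j\<close> on the union of the earlier rows lies in a single earlier \<open>S\<^sub>i\<close>, and calling \<open>i\<close> the parent
  of \<open>j\<close> makes the light rows into a tree in which the rows meeting a given column are connected.
  Deleting a suitable row \<open>a\<close> separates a union \<open>G\<close> of branches with \<open>k \<le> |G| < 2 k\<close> from the
  rest, and a column outside \<open>S\<^sub>a\<close> has no zero in \<open>G\<close> or no zero outside \<open>G\<close>, which yields an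
  all-one submatrix.
\<close>

section \<open>Corner-closed relations and the number of their pairs\<close>

text \<open>This is \<open>Q\<close>-freeness read off the positions of the zeros, with
  \<open>Z i j\<close> standing for a zero at \<open>(i, j)\<close>.\<close>

definition corner_closed :: "(nat \<Rightarrow> nat \<Rightarrow> bool) \<Rightarrow> bool" where
  "corner_closed Z \<longleftrightarrow>
    (\<forall>i i' j j'. i < i' \<longrightarrow> j < j' \<longrightarrow> Z i j' \<longrightarrow> Z i' j \<longrightarrow> Z i' j' \<longrightarrow> Z i j)"

lemma corner_closedD:
  assumes "corner_closed Z" "i \<le> i'" "j \<le> j'" "Z i j'" "Z i' j" "Z i' j'"
  shows "Z i j"
  using assms unfolding corner_closed_def by (metis le_neq_implies_less)

text \<open>The set is an initial segment of \<open>S\<close>, so the rank of its largest element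
  bounds its size. For \<open>k = 0\<close> it is empty, in keeping with the truncated
  \<open>k - 1\<close>.\<close>

lemma card_small_rank_le:
  fixes S :: "nat set"
  assumes "finite S"
  shows "card {x \<in> S. card {y \<in> S. y \<le> x} < k} \<le> k - 1"
proof (cases "{x \<in> S. card {y \<in> S. y \<le> x} < k} = {}")
  case False
  define T where "T = {x \<in> S. card {y \<in> S. y \<le> x} < k}"
  have fin: "finite T" and ne: "T \<noteq> {}"
    using assms False by (auto simp: T_def)
  have "T \<subseteq> {y \<in> S. y \<le> Max T}"
    using fin by (auto simp: T_def)
  then have "card T \<le> card {y \<in> S. y \<le> Max T}"
    using assms by (intro card_mono) auto
  moreover have "card {y \<in> S. y \<le> Max T} < k"
    using Max_in[OF fin ne] by (simp add: T_def)
  ultimately show ?thesis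
    unfolding T_def by linarith
next
  case True
  then show ?thesis by (simp only: card.empty)
qed

lemma card_corner_closed_le:
  fixes Z :: "nat \<Rightarrow> nat \<Rightarrow> bool"
  assumes closed: "corner_closed Z"
    and dom: "\<And>i j. Z i j \<Longrightarrow> i < n \<and> j < n"
    and no_block: "\<And>I J. card I = k \<Longrightarrow> card J = k \<Longrightarrow> I \<subseteq> {..<n} \<Longrightarrow> J \<subseteq> {..<n}
                     \<Longrightarrow> \<exists>i\<in>I. \<exists>j\<in>J. \<not> Z i j"
  shows "(\<Sum>i<n. card {j. Z i j}) \<le> 2 * (k - 1) * n"
proof -
  define row where "row i = {j. Z i j}" for i
  define col where "col j = {i. Z i j}" for j
  have fin: "finite (row i)" "finite (col j)" for i j
    by (rule finite_subset[of _ "{..<n}"]; auto simp: row_def col_def dest: dom)+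
  \<comment> \<open>Zeros are charged to their row in \<open>P\<close> or to their column in
    \<open>R\<close>. \<open>R\<close> lists the column first, hence the swap below.\<close>
  define P where "P = (SIGMA i:{..<n}. {x \<in> row i. card {y \<in> row i. y \<le> x} < k})"
  define R where "R = (SIGMA j:{..<n}. {x \<in> col j. card {y \<in> col j. y \<le> x} < k})"
  have rank: "card {y \<in> row i. y \<le> j} < k \<or> card {y \<in> col j. y \<le> i} < k" if "Z i j" for i j
  proof (rule ccontr)
    assume "\<not> ?thesis"
    then obtain I J where IJ: "card I = k" "card J = k"
      "J \<subseteq> {y \<in> row i. y \<le> j}" "I \<subseteq> {y \<in> col j. y \<le> i}"
      by (meson linorder_not_less obtain_subset_with_card_n)
    have "\<forall>x\<in>I. \<forall>y\<in>J. Z x y"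
      using IJ corner_closedD[OF closed _ _ _ _ that] by (auto simp: row_def col_def)
    moreover have "I \<subseteq> {..<n}" "J \<subseteq> {..<n}"
      using IJ dom by (auto simp: row_def col_def)
    ultimately show False
      using no_block[OF IJ(1,2)] by blast
  qed
  have "(\<Sum>i<n. card {j. Z i j}) = card (SIGMA i:{..<n}. row i)"
    using fin by (simp add: row_def)
  also have "\<dots> \<le> card (P \<union> prod.swap ` R)"
  proof (rule card_mono)
    show "finite (P \<union> prod.swap ` R)"
      using fin by (auto simp: P_def R_def)
    show "(SIGMA i:{..<n}. row i) \<subseteq> P \<union> prod.swap ` R"
    proof
      fix x assume "x \<in> (SIGMA i:{..<n}. row i)"
      then obtain i j where x: "x = (i, j)" and "Z i j"
        by (auto simp: row_def)
      then have "(i, j) \<in> P \<or> (j, i) \<in> R"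
        using rank[of i j] dom[of i j] by (auto simp: P_def R_def row_def col_def)
      then show "x \<in> P \<union> prod.swap ` R"
        unfolding x by force
    qed
  qed
  also have "\<dots> \<le> card P + card (prod.swap ` R)"
    by (rule card_Un_le)
  also have "card (prod.swap ` R) = card R"
    by (rule card_image) simp
  also have "card P \<le> n * (k - 1)"
    using sum_bounded_above[of "{..<n}" "\<lambda>i. card {x \<in> row i. card {y \<in> row i. y \<le> x} < k}" "k - 1"]
      card_small_rank_le fin by (simp add: P_def)
  also have "card R \<le> n * (k - 1)"
    using sum_bounded_above[of "{..<n}" "\<lambda>i. card {x \<in> col i. card {y \<in> col i. y \<le> x} < k}" "k - 1"]
      card_small_rank_le fin by (simp add: R_def)
  finally show ?thesis
    by (simp add: algebra_simps)
qed

section \<open>The tree of rows\<close>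

text \<open>Take the last column of row \<open>x\<close> that is shared with an earlier row of
  \<open>L\<close>, and let \<open>a\<close> be such a row. Corner-closedness hands \<open>a\<close>
  every column of \<open>x\<close> further left. If nothing is shared, any earlier row serves, for
  instance \<open>z\<close>.\<close>

lemma corner_closed_parent:
  fixes Z :: "nat \<Rightarrow> nat \<Rightarrow> bool"
  assumes closed: "corner_closed Z"
    and fin: "finite {j. Z x j}"
    and ex: "z \<in> L" "z < x"
  shows "\<exists>a\<in>L. a < x \<and> (\<forall>y\<in>L. y < x \<longrightarrow> (\<forall>j. Z x j \<longrightarrow> Z y j \<longrightarrow> Z a j))"
proof -
  define C where "C = {j. Z x j \<and> (\<exists>y\<in>L. y < x \<and> Z y j)}"
  show ?thesis
  proof (cases "C = {}")
    case True
    then show ?thesis using ex unfolding C_def by blast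
  next
    case False
    have finC: "finite C"
      by (rule finite_subset[OF _ fin]) (auto simp: C_def)
    from Max_in[OF finC False] obtain a where a: "a \<in> L" "a < x" "Z a (Max C)" "Z x (Max C)"
      by (auto simp: C_def)
    have "Z a j" if "y \<in> L" "y < x" "Z x j" "Z y j" for y j
    proof -
      have "j \<le> Max C"
        using that finC by (intro Max_ge) (auto simp: C_def)
      then show ?thesis
        using corner_closedD[OF closed, of a x j "Max C"] a that by auto
    qed
    with a show ?thesis by blast
  qed
qed

text \<open>In the tree on \<open>L\<close> with root \<open>r\<close> and parent map
  \<open>p\<close>, such a \<open>G\<close> is a union of full subtrees hanging from children of
  \<open>a\<close>. The value \<open>p r\<close> is arbitrary, so \<open>r\<close> is kept out of
  the conditions.\<close>

definition branches :: "nat set \<Rightarrow> nat \<Rightarrow> (nat \<Rightarrow> nat) \<Rightarrow> nat \<Rightarrow> nat set \<Rightarrow> bool" where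
  "branches L r p a G \<longleftrightarrow> a \<in> L \<and> G \<subseteq> L - {r} \<and> a \<notin> G \<and>
    (\<forall>x\<in>G. p x \<in> insert a G) \<and> (\<forall>y\<in>L - {r}. p y \<in> G \<longrightarrow> y \<in> G)"

text \<open>Choose \<open>G\<close> of least size among those with at least \<open>k\<close>
  elements. Splitting off the subtree \<open>D\<close> of one child \<open>b\<close> of
  \<open>a\<close> leaves two smaller unions of branches, \<open>G - D\<close> at \<open>a\<close>
  and \<open>D - {b}\<close> at \<open>b\<close>. By minimality both have fewer than
  \<open>k\<close> elements.\<close>

lemma tree_separator:
  fixes L :: "nat set"
  assumes fin: "finite L" and r: "r \<in> L"
    and p: "\<And>x. x \<in> L - {r} \<Longrightarrow> p x \<in> L \<and> p x < x"
    and k: "0 < k" "k < card L"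
  shows "\<exists>a G. branches L r p a G \<and> k \<le> card G \<and> card G < 2 * k"
proof -
  define ok where "ok m \<longleftrightarrow> (\<exists>a G. branches L r p a G \<and> k \<le> card G \<and> card G = m)" for m
  have "branches L r p r (L - {r})"
    using p r by (auto simp: branches_def)
  moreover have "k \<le> card (L - {r})"
    using k fin r by simp
  ultimately have "ok (card (L - {r}))"
    unfolding ok_def by blast
  then obtain m where m: "ok m" and least: "\<And>m'. ok m' \<Longrightarrow> m \<le> m'"
    by (metis LeastI Least_le)
  then obtain a G where G: "branches L r p a G" "k \<le> card G" "card G = m"
    unfolding ok_def by blast
  have minimal: "card G \<le> card H" if "branches L r p b H" "k \<le> card H" for b H
    using least that G unfolding ok_def by blast
  have finG: "finite G"
    using G fin finite_subset by (auto simp: branches_def)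
  have neG: "G \<noteq> {}"
    using G k by auto
  define b where "b = Min G"
  have b: "b \<in> G" and bmin: "\<And>x. x \<in> G \<Longrightarrow> b \<le> x"
    using finG neG by (auto simp: b_def)
  have GL: "G \<subseteq> L - {r}" and aL: "a \<in> L" and aG: "a \<notin> G"
    and up: "\<And>x. x \<in> G \<Longrightarrow> p x \<in> insert a G"
    and down: "\<And>y. y \<in> L - {r} \<Longrightarrow> p y \<in> G \<Longrightarrow> y \<in> G"
    using G(1) by (auto simp: branches_def)
  \<comment> \<open>Parents are smaller, so the parent of the least element of \<open>G\<close>
    cannot lie in \<open>G\<close>.\<close>
  have pb: "p b = a"
    using up[OF b] p[of b] b GL bmin by fastforce
  \<comment> \<open>Edges of \<open>E\<close> run from child to parent, so \<open>D\<close> consists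
    of \<open>b\<close> and its descendants.\<close>
  define E where "E = {(x, y). x \<in> L - {r} \<and> y = p x}"
  define D where "D = {x. (x, b) \<in> E\<^sup>*}"
  have D_step: "x = b \<or> (x \<in> L - {r} \<and> p x \<in> D)" if "x \<in> D" for x
    using that converse_rtranclE[of x b E] unfolding D_def E_def by blast
  have D_child: "y \<in> D" if "y \<in> L - {r}" "p y \<in> D" for y
    using that converse_rtrancl_into_rtrancl[of y "p y" E b] unfolding D_def E_def by blast
  have bD: "b \<in> D"
    by (simp add: D_def)
  have DG: "D \<subseteq> G"
  proof
    fix x assume "x \<in> D"
    then have "(x, b) \<in> E\<^sup>*" by (simp add: D_def)
    then show "x \<in> G"
      by (induction rule: converse_rtrancl_induct) (use b down in \<open>auto simp: E_def\<close>)
  qed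
  have "branches L r p a (G - D)"
    unfolding branches_def
    using aL GL aG up down D_child D_step pb by blast
  then have rest: "card (G - D) < k"
    using minimal[of a "G - D"] psubset_card_mono[OF finG, of "G - D"] bD b by force
  have "branches L r p b (D - {b})"
    unfolding branches_def
    using GL DG b D_child D_step pb aG by blast
  then have "card (D - {b}) < k"
    using minimal[of b "D - {b}"] psubset_card_mono[OF finG, of "D - {b}"] DG b by force
  then have "card D \<le> k"
    using bD finite_subset[OF DG finG] by (simp add: card_Diff_singleton)
  then have "card G < 2 * k"
    using rest card_Diff_subset[OF finite_subset[OF DG finG] DG] by linarith
  with G show ?thesis by blast
qed

text \<open>Replace the larger of \<open>x\<close> and \<open>y\<close> by its parent, which still
  meets column \<open>j\<close>. The row outside \<open>G\<close> stays outside, while the row in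
  \<open>G\<close> can leave only through \<open>a\<close>; since \<open>x + y\<close> decreases,
  this must happen.\<close>

lemma separated_columns:
  assumes G: "branches L r p a G"
    and p: "\<And>x. x \<in> L - {r} \<Longrightarrow> p x \<in> L \<and> p x < x"
    and root: "\<And>x. x \<in> L \<Longrightarrow> r \<le> x"
    and join: "\<And>x y j. x \<in> L - {r} \<Longrightarrow> y \<in> L \<Longrightarrow> y < x \<Longrightarrow> Z x j \<Longrightarrow> Z y j \<Longrightarrow> Z (p x) j"
    and "x \<in> G" "y \<in> L - G" "Z x j" "Z y j"
  shows "Z a j"
  using assms(5-)
proof (induction "x + y" arbitrary: x y rule: less_induct)
  case less
  have GL: "G \<subseteq> L - {r}" and up: "\<And>x. x \<in> G \<Longrightarrow> p x \<in> insert a G"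
    and down: "\<And>y. y \<in> L - {r} \<Longrightarrow> p y \<in> G \<Longrightarrow> y \<in> G"
    using G by (auto simp: branches_def)
  consider "y < x" | "x < y"
    using less.prems by fastforce
  then show ?case
  proof cases
    case 1
    then have "Z (p x) j" "p x < x"
      using less.prems GL join p by blast+
    then show ?thesis
      using up[OF \<open>x \<in> G\<close>] less.hyps[of "p x" y] less.prems by auto
  next
    case 2
    then have y: "y \<in> L - {r}"
      using less.prems GL root by fastforce
    then have "Z (p y) j" "p y < y" "p y \<in> L - G"
      using less.prems GL join p 2 down by blast+
    then show ?thesis
      using less.hyps[of x "p y"] less.prems by auto
  qed
qed

section \<open>Homogeneous blocks of corner-closed relations\<close>

text \<open>Markov's inequality in counting form.\<close>

lemma card_heavy_le:
  fixes w :: "'a \<Rightarrow> nat"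
  assumes "finite S"
  shows "card {i \<in> S. t \<le> w i} * t \<le> sum w S"
proof -
  have "card {i \<in> S. t \<le> w i} * t \<le> (\<Sum>i\<in>{i \<in> S. t \<le> w i}. w i)"
    using sum_bounded_below[of "{i \<in> S. t \<le> w i}" t w] by simp
  also have "\<dots> \<le> sum w S"
    using assms by (intro sum_mono2) auto
  finally show ?thesis .
qed

lemma corner_closed_block:
  fixes Z :: "nat \<Rightarrow> nat \<Rightarrow> bool"
  assumes closed: "corner_closed Z"
    and dom: "\<And>i j. Z i j \<Longrightarrow> i < n \<and> j < n"
    and k: "2 \<le> k" "16 * (k - 1) < n"
  shows "\<exists>I J v. card I = k \<and> card J = k \<and> I \<subseteq> {..<n} \<and> J \<subseteq> {..<n} \<and> (\<forall>i\<in>I. \<forall>j\<in>J. Z i j = v)"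
proof (rule ccontr)
  assume none: "\<not> ?thesis"
  have no_block: "\<exists>i\<in>I. \<exists>j\<in>J. Z i j \<noteq> v"
    if large: "k \<le> card I" "k \<le> card J" and sub: "I \<subseteq> {..<n}" "J \<subseteq> {..<n}" for I J v
  proof -
    obtain I' J' where sub': "I' \<subseteq> I" "J' \<subseteq> J" and card': "card I' = k" "card J' = k"
      using large by (meson obtain_subset_with_card_n)
    have "I' \<subseteq> {..<n}" "J' \<subseteq> {..<n}"
      using sub sub' by blast+
    then have "\<not> (\<forall>i\<in>I'. \<forall>j\<in>J'. Z i j = v)"
      using none card' by metis
    then show ?thesis
      using sub' by blast
  qed
  define row where "row i = {j. Z i j}" for i
  have row_sub: "row i \<subseteq> {..<n}" for i
    using dom by (auto simp: row_def)
  then have fin_row: "finite (row i)" for i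
    using finite_subset by blast
  have total: "(\<Sum>i<n. card (row i)) \<le> 2 * (k - 1) * n"
    unfolding row_def using no_block[of _ _ True]
    by (intro card_corner_closed_le[OF closed dom]) auto
  \<comment> \<open>The threshold leaves every light row at least \<open>2 k\<close> ones, to be
    shared by the two column sets \<open>J1\<close> and \<open>J2\<close>.\<close>
  define H where "H = {i \<in> {..<n}. n + 1 - 2 * k \<le> card (row i)}"
  define L where "L = {..<n} - H"
  have finL: "finite L"
    by (simp add: L_def)
  \<comment> \<open>With \<open>3 k\<close> light rows, at least \<open>k\<close> remain outside a
    \<open>G\<close> of size below \<open>2 k\<close>.\<close>
  have heavy: "card H + 3 * k \<le> n"
  proof (rule ccontr)
    assume "\<not> ?thesis"
    then have *: "n < card H + 3 * k" by simp
    \<comment> \<open>More than \<open>n - 3 k\<close> heavy rows means at least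
      \<open>13 m - 1\<close>, hence \<open>8 m\<close> of them as \<open>1 \<le> m\<close>. Each
      has at least \<open>n / 2\<close> zeros, against a total of at most
      \<open>2 m n\<close>.\<close>
    obtain m where m: "k = Suc m" "1 \<le> m" "16 * m < n"
      using k by (cases k) auto
    have "8 * (k - 1) \<le> card H"
      using * m by linarith
    moreover have "n \<le> 2 * (n + 1 - 2 * k)"
      using m by linarith
    ultimately have "8 * (k - 1) * n \<le> card H * (2 * (n + 1 - 2 * k))"
      by (rule mult_le_mono)
    also have "\<dots> = 2 * (card H * (n + 1 - 2 * k))"
      by simp
    also have "\<dots> \<le> 2 * (2 * (k - 1) * n)"
      using order_trans[OF card_heavy_le[of "{..<n}" "n + 1 - 2 * k" "\<lambda>i. card (row i)"] total]
      unfolding H_def by (intro mult_le_mono2) auto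
    finally show False
      using m by simp
  qed
  have cardL: "3 * k \<le> card L"
    using heavy card_Diff_subset[of H "{..<n}"] by (simp add: L_def H_def subset_iff)
  define r where "r = Min L"
  have "L \<noteq> {}"
    using cardL k by auto
  then have rL: "r \<in> L" and root: "\<And>x. x \<in> L \<Longrightarrow> r \<le> x"
    using finL by (auto simp: r_def)
  have "\<forall>x\<in>L - {r}. \<exists>a. a \<in> L \<and> a < x \<and> (\<forall>y\<in>L. y < x \<longrightarrow> (\<forall>j. Z x j \<longrightarrow> Z y j \<longrightarrow> Z a j))"
  proof
    fix x assume "x \<in> L - {r}"
    then have "r < x"
      using root[of x] by auto
    then show "\<exists>a. a \<in> L \<and> a < x \<and> (\<forall>y\<in>L. y < x \<longrightarrow> (\<forall>j. Z x j \<longrightarrow> Z y j \<longrightarrow> Z a j))"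
      using corner_closed_parent[OF closed _ rL, of x] fin_row[of x] by (auto simp: row_def)
  qed
  then obtain p where p: "\<And>x. x \<in> L - {r} \<Longrightarrow> p x \<in> L \<and> p x < x"
    and join: "\<And>x y j. x \<in> L - {r} \<Longrightarrow> y \<in> L \<Longrightarrow> y < x \<Longrightarrow> Z x j \<Longrightarrow> Z y j \<Longrightarrow> Z (p x) j"
    unfolding bchoice_iff by blast
  obtain a G where G: "branches L r p a G" "k \<le> card G" "card G < 2 * k"
    using tree_separator[OF finL rL p, of k] cardL k by auto
  have GL: "G \<subseteq> L" and aL: "a \<in> L"
    using G by (auto simp: branches_def)
  have Ln: "L \<subseteq> {..<n}"
    by (auto simp: L_def)
  have rest: "k \<le> card (L - G)"
    using card_Diff_subset[OF finite_subset[OF GL finL] GL] cardL G by linarith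
  \<comment> \<open>Both \<open>G\<close> against \<open>J1\<close> and \<open>L - G\<close> against
    \<open>J2\<close> are all-one blocks, and together the two sets cover the columns in which row
    \<open>a\<close> has a one.\<close>
  define J1 where "J1 = {j \<in> {..<n} - row a. \<forall>i\<in>G. \<not> Z i j}"
  define J2 where "J2 = {j \<in> {..<n} - row a. \<forall>i\<in>L - G. \<not> Z i j}"
  have "Z a j" if "x \<in> G" "y \<in> L - G" "Z x j" "Z y j" for x y j
    using G(1) p root join that by (rule separated_columns)
  then have "{..<n} - row a \<subseteq> J1 \<union> J2"
    by (auto simp: J1_def J2_def row_def)
  then have "card ({..<n} - row a) \<le> card (J1 \<union> J2)"
    by (intro card_mono) (auto simp: J1_def J2_def)
  also have "\<dots> \<le> card J1 + card J2"
    by (rule card_Un_le)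
  finally have "n - card (row a) \<le> card J1 + card J2"
    by (simp add: card_Diff_subset fin_row row_sub)
  moreover have "card (row a) + 2 * k \<le> n"
    using aL by (auto simp: L_def H_def)
  ultimately have "k \<le> card J1 \<or> k \<le> card J2"
    by linarith
  then show False
  proof
    assume "k \<le> card J1"
    then show False
      using no_block[of G J1 False] G GL Ln by (auto simp: J1_def)
  next
    assume "k \<le> card J2"
    then show False
      using no_block[of "L - G" J2 False] rest Ln by (auto simp: J2_def)
  qed
qed

section \<open>From relations back to matrices\<close>

lemma homogeneous_submatrixI:
  assumes "I \<subseteq> {..<dim_row A}" "J \<subseteq> {..<dim_col A}"
    and eq: "\<And>i j. i \<in> I \<Longrightarrow> j \<in> J \<Longrightarrow> A $$ (i, j) = v"
  shows "homogeneous_mat (submatrix A I J)"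
proof -
  have sets: "{i. i < dim_row A \<and> i \<in> I} = I" "{j. j < dim_col A \<and> j \<in> J} = J"
    using assms by auto
  have "x = v" if x: "x \<in> elements_mat (submatrix A I J)" for x
  proof -
    obtain i j where ij: "i < card I" "j < card J" "x = submatrix A I J $$ (i, j)"
      using elements_matD[OF x] by (auto simp: dim_submatrix sets)
    then have "x = A $$ (pick I i, pick J j)"
      by (simp add: submatrix_index sets)
    moreover have "pick I i \<in> I" "pick J j \<in> J"
      using ij by (auto intro: pick_in_set_le)
    ultimately show ?thesis
      using eq by simp
  qed
  then show ?thesis
    unfolding homogeneous_mat_def by metis
qed

lemma zero_one_matD:
  assumes "zero_one_mat A" "i < dim_row A" "j < dim_col A"
  shows "A $$ (i, j) \<in> {0, 1}"
  using assms elements_matI[of A "dim_row A" "dim_col A" i j "A $$ (i, j)"]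
  by (simp add: zero_one_mat_def subset_iff)

text \<open>A one in the upper left corner would complete the three zeros to a copy of
  \<open>Q_mat\<close>.\<close>

lemma free_Q_mat_corner_closed:
  assumes "A \<in> carrier_mat n n" "zero_one_mat A" "free_mat Q_mat A"
  shows "corner_closed (\<lambda>i j. i < n \<and> j < n \<and> A $$ (i, j) = 0)"
  unfolding corner_closed_def
proof (intro allI impI)
  fix i i' j j' :: nat
  assume less: "i < i'" "j < j'"
    and "i < n \<and> j' < n \<and> A $$ (i, j') = 0" "i' < n \<and> j < n \<and> A $$ (i', j) = 0"
      "i' < n \<and> j' < n \<and> A $$ (i', j') = 0"
  then have bounds: "i < n" "i' < n" "j < n" "j' < n"
    and zeros: "A $$ (i, j') = 0" "A $$ (i', j) = 0" "A $$ (i', j') = 0"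
    by auto
  have "A $$ (i, j) \<in> {0, 1}"
    using assms bounds zero_one_matD by auto
  moreover have "A $$ (i, j) \<noteq> 1"
  proof
    assume one: "A $$ (i, j) = 1"
    have dims: "dim_row Q_mat = 2" "dim_col Q_mat = 2"
      by (simp_all add: Q_mat_def mat_of_rows_list_def)
    have "contains_mat A Q_mat"
      unfolding contains_mat_def dims
      by (rule exI[of _ "\<lambda>a. if a = 0 then i else i'"], rule exI[of _ "\<lambda>b. if b = 0 then j else j'"])
        (use assms less bounds zeros one in
          \<open>auto simp: strict_mono_on_def Q_mat_def mat_of_rows_list_def less_2_cases_iff\<close>)
    with assms show False
      by (simp add: free_mat_def)
  qed
  ultimately show "i < n \<and> j < n \<and> A $$ (i, j) = 0"
    using bounds by auto
qed

theorem theorem2p2: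
  shows "\<exists>c::real. c > 1 / 20 \<and>
    (\<forall>(n::nat) A. A \<in> carrier_mat n n \<longrightarrow> zero_one_mat A \<longrightarrow> free_mat Q_mat A \<longrightarrow>
      has_homogeneous_submatrix A (nat \<lceil>c * real n\<rceil>) (nat \<lceil>c * real n\<rceil>))"
proof (intro exI[of _ "1 / 16"] conjI allI impI)
  fix n :: nat and A :: "int mat"
  assume A: "A \<in> carrier_mat n n" "zero_one_mat A" "free_mat Q_mat A"
  define k where "k = nat \<lceil>1 / 16 * real n\<rceil>"
  \<comment> \<open>Rounding \<open>n / 16\<close> up adds less than one. For \<open>n = 0\<close>
    the strict bound fails, hence the guard \<open>0 < k\<close>.\<close>
  have small: "16 * (k - 1) < n" if "0 < k"
    using that unfolding k_def by linarith
  define Z where "Z i j \<longleftrightarrow> i < n \<and> j < n \<and> A $$ (i, j) = 0" for i j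
  have "\<exists>I J v. card I = k \<and> card J = k \<and> I \<subseteq> {..<n} \<and> J \<subseteq> {..<n} \<and>
      (\<forall>i\<in>I. \<forall>j\<in>J. Z i j = v)"
  proof -
    \<comment> \<open>The block lemma assumes \<open>2 \<le> k\<close>; below that an empty block or
      a single entry is enough.\<close>
    consider "k = 0" | "k = 1" | "2 \<le> k" by linarith
    then show ?thesis
    proof cases
      case 1
      then show ?thesis by (intro exI[of _ "{}"]) auto
    next
      case 2
      then show ?thesis
        using small by (intro exI[of _ "{0}"] exI[of _ "Z 0 0"]) auto
    next
      case 3
      have "corner_closed Z"
        using free_Q_mat_corner_closed[OF A] by (simp add: Z_def[abs_def])
      then show ?thesis
        using corner_closed_block[of Z n k] 3 small by (simp add: Z_def)
    qed
  qed
  then obtain I J v where IJ: "card I = k" "card J = k" "I \<subseteq> {..<n}" "J \<subseteq> {..<n}"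
    and v: "\<forall>i\<in>I. \<forall>j\<in>J. Z i j = v"
    by blast
  have "A $$ (i, j) = (if v then 0 else 1)" if "i \<in> I" "j \<in> J" for i j
  proof -
    have "i < n" "j < n" "Z i j = v"
      using that IJ v by auto
    moreover from this have "A $$ (i, j) \<in> {0, 1}"
      using A(1,2) zero_one_matD by auto
    ultimately show ?thesis
      by (auto simp: Z_def)
  qed
  then have "homogeneous_mat (submatrix A I J)"
    using A IJ by (intro homogeneous_submatrixI) auto
  then show "has_homogeneous_submatrix A (nat \<lceil>1 / 16 * real n\<rceil>) (nat \<lceil>1 / 16 * real n\<rceil>)"
    using A IJ unfolding has_homogeneous_submatrix_def k_def[symmetric] by auto
qed simp

end
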